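(* Let $d \geq 1$ and let $A$ be a finite, non-empty subset of $\mathbb{R}^d$ such that $\dim(A) = d$. Suppose that, for some $v \in \mathbb{R}^d \setminus \{0\}$, the set $A$ is contained in a union of $r$ translates of the line $L_v = \{\lambda v : \lambda \in \mathbb{R}\}$. Then \[ |(A-A) \setminus L_v| \geq (2d-2)|A| - 2d^2 r. \]
   Context: For finite sets $A, B \subseteq \mathbb{R}^d$, $A - B = \{a-b : a \in A,\ b \in B\}$. For a non-empty set $A \subseteq \mathbb{R}^d$, $\dim(A)$ denotes the dimension of the affine subspace spanned by $A$. *)

theory Defs
  imports "HOL-Analysis.Analysis"
begin

text \<open>The operator \<open>-\<close> on sets is set-theoretic difference, so the difference set
  \<open>{a - b. a \<in> A, b \<in> B}\<close> needs its own name.\<close>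

definition diffset :: "'a::minus set \<Rightarrow> 'a set \<Rightarrow> 'a set"
  where "diffset A B = {a - b |a b. a \<in> A \<and> b \<in> B}"

definition line_through_0 :: "'a::real_vector \<Rightarrow> 'a set"
  where "line_through_0 v = {c *\<^sub>R v |c. c \<in> (UNIV :: real set)}"

end

theory Submission
  imports Defs
begin

text \<open>
  Project \<open>A\<close> along \<open>v\<close> to a set \<open>B\<close> of dimension \<open>n = d - 1\<close> and give \<open>b \<in> B\<close> the weight
  \<open>a b = |fibre of b| - 1\<close>. The fibre of \<open>A - A\<close> over \<open>b - b'\<close> has at least \<open>a b + a b'\<close> elements,
  so it suffices to show that any function \<open>g\<close> with \<open>g (b - b') \<ge> a b + a b'\<close> sums over the nonzero
  differences to at least \<open>2 n\<close> times the total weight of \<open>B\<close>; no error term is needed there.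

  Let \<open>T\<close> be the heaviest facet of \<open>B\<close> and \<open>S\<close> the opposite face, which lies in a facet and hence is
  not heavier than \<open>T\<close>. The differences in \<open>\<plusminus>(T - S)\<close> are not differences of points of \<open>B\<close>
  outside \<open>S\<close>, and by a weighted form of Ruzsa's sumset inequality they contribute
  \<open>2 (weight T + n * weight S)\<close>. Either \<open>B\<close> without \<open>S\<close> still has dimension \<open>n\<close>, or it equals \<open>T\<close>; in both cases induction applies.

  The sumset inequality is proved likewise: take a facet of \<open>T\<close> and the parallel face of \<open>S\<close>, bound
  their sum by induction on the dimension, and remove the lighter of the two; this does not lower
  the dimension of the sum as long as both sets are full-dimensional.
\<close>

section \<open>Facets of finite point sets\<close>

text \<open>The supporting hyperplane cuts a proper nonempty face from the polytope
  \<open>convex hull B\<close>, and such a face lies in a facet \<open>F\<close>. Since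
  \<open>F\<close> is the hull of some points of \<open>B\<close>, all of them in its hyperplane,
  passing from \<open>F\<close> to its points of \<open>B\<close> keeps the dimension.\<close>

lemma face_subset_facet_points:
  fixes B :: "'a::euclidean_space set"
  assumes "finite B" and le: "\<And>x. x \<in> B \<Longrightarrow> l \<bullet> x \<le> \<beta>"
    and ex: "x0 \<in> B" "l \<bullet> x0 = \<beta>" and nex: "x1 \<in> B" "l \<bullet> x1 \<noteq> \<beta>"
  obtains l' \<beta>' where "\<And>x. x \<in> B \<Longrightarrow> l' \<bullet> x \<le> \<beta>'"
    "{x\<in>B. l \<bullet> x = \<beta>} \<subseteq> {x\<in>B. l' \<bullet> x = \<beta>'}"
    "aff_dim {x\<in>B. l' \<bullet> x = \<beta>'} = aff_dim B - 1"
proof -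
  let ?P = "convex hull B" and ?C = "convex hull B \<inter> {x. l \<bullet> x = \<beta>}"
  have poly: "polyhedron ?P"
    using assms(1) by (simp add: polyhedron_convex_hull)
  have "?P \<subseteq> {x. l \<bullet> x \<le> \<beta>}"
    by (rule hull_minimal) (auto simp: le convex_halfspace_le)
  then have face: "?C face_of ?P"
    by (intro face_of_Int_supporting_hyperplane_le) auto
  have "?C \<noteq> {}" "?C \<noteq> ?P"
    using ex nex hull_inc[of _ B convex] by blast+
  then obtain F where F: "F facet_of ?P" "?C \<subseteq> F"
    using face_of_polyhedron_subset_facet[OF poly face] by blast
  obtain l' \<beta>' where l': "l' \<noteq> 0" "?P \<subseteq> {x. l' \<bullet> x \<le> \<beta>'}" "F = ?P \<inter> {x. l' \<bullet> x = \<beta>'}"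
    using facet_of_polyhedron[OF poly F(1)] by blast
  let ?F = "{x\<in>B. l' \<bullet> x = \<beta>'}"
  have "F face_of ?P"
    using F(1) facet_of_imp_face_of by blast
  then obtain B' where B': "B' \<subseteq> B" "F = convex hull B'"
    using face_of_convex_hull_subset[OF finite_imp_compact[OF assms(1)]] by metis
  have "B' \<subseteq> ?F"
    using B' l'(3) hull_subset[of B' convex] by blast
  moreover have "?F \<subseteq> F"
    using l'(3) hull_subset[of B convex] by blast
  ultimately have "aff_dim ?F = aff_dim F"
    using B'(2) by (metis aff_dim_convex_hull aff_dim_subset order_antisym)
  also have "\<dots> = aff_dim B - 1"
    using F(1) by (simp add: facet_of_def aff_dim_convex_hull)
  finally show ?thesis
    using that[of l' \<beta>'] l'(2,3) F(2) hull_subset[of B convex] by blast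
qed

lemma facet_points_exist:
  fixes B :: "'a::euclidean_space set"
  assumes "finite B" and "aff_dim B \<ge> 1"
  obtains l \<beta> where "\<And>x. x \<in> B \<Longrightarrow> l \<bullet> x \<le> \<beta>"
    "aff_dim {x\<in>B. l \<bullet> x = \<beta>} = aff_dim B - 1"
proof -
  obtain p where p: "p \<in> B"
    using assms(2) by fastforce
  have "B \<noteq> {p}"
    using assms(2) by auto
  then obtain q where q: "q \<in> B" "q \<noteq> p"
    using p by blast
  \<comment> \<open>This functional separates \<open>p\<close> from \<open>q\<close>, so its maximum
    over \<open>B\<close> cuts out a proper face.\<close>
  define l where "l = q - p"
  have "l \<bullet> q \<noteq> l \<bullet> p"
    using q(2) inner_eq_zero_iff[of "q - p"] by (simp add: l_def inner_diff_right)
  define \<beta> where "\<beta> = Max ((\<bullet>) l ` B)"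
  have le: "l \<bullet> x \<le> \<beta>" if "x \<in> B" for x
    using assms(1) that by (simp add: \<beta>_def)
  have "\<beta> \<in> (\<bullet>) l ` B"
    unfolding \<beta>_def using assms(1) p by (intro Max_in) auto
  then obtain x0 where x0: "x0 \<in> B" "l \<bullet> x0 = \<beta>"
    by blast
  obtain x1 where "x1 \<in> B" "l \<bullet> x1 \<noteq> \<beta>"
    using p q(1) \<open>l \<bullet> q \<noteq> l \<bullet> p\<close> by metis
  then show ?thesis
    using face_subset_facet_points[OF assms(1) le x0] that by metis
qed

section \<open>Weighted sumsets\<close>

text \<open>A weighted, error-free form of Ruzsa's bound \<open>|T + S| \<ge> |T| + d |S| - O(1)\<close> for
  \<open>|S| \<le> |T|\<close>: every \<open>t + s\<close> carries at least the weight \<open>a t + c s\<close>.\<close>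

definition sumset_bound ::
    "nat \<Rightarrow> ('a::plus \<Rightarrow> real) \<Rightarrow> ('a \<Rightarrow> real) \<Rightarrow> ('a \<Rightarrow> real) \<Rightarrow> 'a set \<Rightarrow> 'a set \<Rightarrow> bool" where
  "sumset_bound e a c g T S \<longleftrightarrow>
     sum a T + sum c S + real e * min (sum a T) (sum c S) \<le> sum g (T + S)"

lemma sumset_bound_commute:
  fixes T :: "'a::ab_semigroup_add set"
  shows "sumset_bound e a c g T S \<longleftrightarrow> sumset_bound e c a g S T"
  by (simp add: sumset_bound_def add.commute min.commute)

text \<open>The single translate \<open>t + S\<close> by a heaviest point \<open>t\<close> of
  \<open>T\<close> suffices: it carries \<open>card S * a t + sum c S\<close>, and
  \<open>card S\<close> copies of the largest weight cover \<open>sum a T\<close>.\<close>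

lemma sumset_bound_0_aux:
  fixes T S :: "'a::cancel_ab_semigroup_add set"
  assumes fin: "finite T" "finite S" and "T \<noteq> {}" and card: "card T \<le> card S"
    and a: "\<And>t. t \<in> T \<Longrightarrow> 0 \<le> a t" and c: "\<And>s. s \<in> S \<Longrightarrow> 0 \<le> c s"
    and g: "\<And>t s. t \<in> T \<Longrightarrow> s \<in> S \<Longrightarrow> a t + c s \<le> g (t + s)"
  shows "sumset_bound 0 a c g T S"
proof -
  have "Max (a ` T) \<in> a ` T"
    using fin \<open>T \<noteq> {}\<close> by simp
  then obtain t where t: "t \<in> T" "a t = Max (a ` T)"
    by (metis imageE)
  have "a x \<le> a t" if "x \<in> T" for x
    using fin that t(2) by simp
  then have "sum a T \<le> real (card T) * a t"
    using sum_bounded_above by metis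
  also have "\<dots> \<le> real (card S) * a t"
    using card a[OF t(1)] by (simp add: mult_right_mono)
  finally have "sum a T + sum c S \<le> (\<Sum>s\<in>S. a t + c s)"
    by (simp add: sum.distrib)
  also have "\<dots> \<le> (\<Sum>s\<in>S. g (t + s))"
    by (intro sum_mono g t(1))
  also have "\<dots> = sum g ((+) t ` S)"
    by (simp add: sum.reindex inj_on_def)
  also have "\<dots> \<le> sum g (T + S)"
  proof (rule sum_mono2)
    fix x assume "x \<in> (T + S) - (+) t ` S"
    then obtain t' s where "t' \<in> T" "s \<in> S" "x = t' + s"
      by (auto elim: set_plus_elim)
    then show "0 \<le> g x"
      using a[of t'] c[of s] g[of t' s] by simp
  qed (use fin t(1) in \<open>auto simp: finite_set_plus\<close>)
  finally show ?thesis
    by (simp add: sumset_bound_def)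
qed

lemma sumset_bound_0:
  fixes T S :: "'a::cancel_ab_semigroup_add set"
  assumes "finite T" "finite S" "T \<noteq> {}" "S \<noteq> {}"
    and "\<And>t. t \<in> T \<Longrightarrow> 0 \<le> a t" and "\<And>s. s \<in> S \<Longrightarrow> 0 \<le> c s"
    and "\<And>t s. t \<in> T \<Longrightarrow> s \<in> S \<Longrightarrow> a t + c s \<le> g (t + s)"
  shows "sumset_bound 0 a c g T S"
proof (cases "card T \<le> card S")
  case True
  then show ?thesis
    by (intro sumset_bound_0_aux assms) auto
next
  case False
  have "sumset_bound 0 c a g S T"
  proof (rule sumset_bound_0_aux)
    show "c s + a t \<le> g (s + t)" if "s \<in> S" "t \<in> T" for s t
      using assms(7)[OF that(2,1)] by (simp add: add.commute)
  qed (use assms False in auto)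
  then show ?thesis
    using sumset_bound_commute by blast
qed

section \<open>Splitting a sumset over cosets\<close>

lemma dim_Un_le_card:
  fixes V :: "'a::euclidean_space set"
  assumes "finite X"
  shows "dim (V \<union> X) \<le> dim V + card X"
  using assms
proof (induction X)
  case (insert x X)
  then show ?case
    by (auto simp: dim_insert)
qed simp

text \<open>Truncation at \<open>s\<close> is subadditive on nonnegative reals. This recombines the
  minima that arise coset by coset.\<close>

lemma sum_min_le:
  fixes f :: "'b \<Rightarrow> real"
  assumes "finite R" and "\<And>r. r \<in> R \<Longrightarrow> 0 \<le> f r" and "0 \<le> s"
  shows "min (sum f R) s \<le> (\<Sum>r\<in>R. min (f r) s)"
  using assms
proof (induction R)
  case (insert r R)
  then have "0 \<le> (\<Sum>r\<in>R. min (f r) s)" "0 \<le> f r"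
    by (auto intro!: sum_nonneg)
  moreover have "min (sum f R) s \<le> (\<Sum>r\<in>R. min (f r) s)"
    using insert by simp
  ultimately show ?case
    using insert.hyps by auto
qed simp

text \<open>If \<open>S\<close> has dimension \<open>f < e\<close>, then \<open>T\<close> meets at least \<open>e - f + 1\<close> cosets of the direction
  space of \<open>S\<close>, and their sums with \<open>S\<close> are disjoint.\<close>

lemma sumset_bound_cosets:
  fixes T S :: "'a::euclidean_space set"
  assumes fin: "finite T" "finite S" and ne: "T \<noteq> {}" "S \<noteq> {}"
    and a: "\<And>t. t \<in> T \<Longrightarrow> 0 \<le> a t" and c: "\<And>s. s \<in> S \<Longrightarrow> 0 \<le> c s"
    and dim: "int e \<le> aff_dim (T + S)" and f: "aff_dim S = int f" "f \<le> e"
    and bound: "\<And>T'. T' \<subseteq> T \<Longrightarrow> T' \<noteq> {} \<Longrightarrow> sumset_bound f a c g T' S"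
  shows "sumset_bound e a c g T S"
proof -
  obtain s0 where s0: "s0 \<in> S"
    using ne by blast
  define D where "D = (\<lambda>s. s - s0) ` S"
  define U where "U = span D"
  have U: "subspace U"
    by (simp add: U_def)
  have SU: "s - s' \<in> U" if "s \<in> S" "s' \<in> S" for s s'
  proof -
    have "(s - s0) - (s' - s0) \<in> U"
      unfolding U_def by (intro span_diff span_base) (auto simp: D_def that)
    then show ?thesis
      by simp
  qed
  \<comment> \<open>\<open>\<rho> t\<close> represents the coset \<open>t + U\<close> inside
    \<open>T\<close>. Congruent points give the same predicate under \<open>SOME\<close>, hence
    literally the same representative.\<close>
  define \<rho> where "\<rho> t = (SOME r. r \<in> T \<and> t - r \<in> U)" for t
  have \<rho>: "\<rho> t \<in> T" "t - \<rho> t \<in> U" if "t \<in> T" for t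
    using someI[of "\<lambda>r. r \<in> T \<and> t - r \<in> U" t] that U
    by (auto simp: \<rho>_def subspace_0)
  have \<rho>_eq: "\<rho> t = \<rho> t'" if "t - t' \<in> U" for t t'
  proof -
    have "t - r \<in> U \<longleftrightarrow> t' - r \<in> U" for r
      using subspace_add[OF U that, of "t' - r"] subspace_diff[OF U _ that, of "t - r"] by auto
    then show ?thesis
      by (simp add: \<rho>_def)
  qed
  define R where "R = \<rho> ` T"
  define C where "C r = {t \<in> T. \<rho> t = r}" for r
  have finR: "finite R" and R_ne: "R \<noteq> {}"
    using fin ne by (auto simp: R_def)
  obtain r0 where r0: "r0 \<in> R"
    using R_ne by blast
  let ?X = "(\<lambda>r. r - r0) ` (R - {r0})"
  \<comment> \<open>Modulo the direction space of \<open>S\<close>, the sumset is spanned by the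
    differences of representatives. There are \<open>card R - 1\<close> nonzero ones, so
    \<open>e \<le> f + card R - 1\<close>.\<close>
  have "(\<lambda>x. x - (r0 + s0)) ` (T + S) \<subseteq> span (D \<union> ?X)"
  proof
    fix y assume "y \<in> (\<lambda>x. x - (r0 + s0)) ` (T + S)"
    then obtain t s where ts: "t \<in> T" "s \<in> S" and y: "y = t + s - (r0 + s0)"
      by (auto elim: set_plus_elim)
    have "U \<subseteq> span (D \<union> ?X)"
      by (simp add: U_def span_mono)
    then have 1: "t - \<rho> t \<in> span (D \<union> ?X)" "s - s0 \<in> span (D \<union> ?X)"
      using \<rho>(2)[OF ts(1)] SU[OF ts(2) s0] by auto
    have 2: "\<rho> t - r0 \<in> span (D \<union> ?X)"
    proof (cases "\<rho> t = r0")
      case False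
      then show ?thesis
        using ts(1) by (intro span_base) (auto simp: R_def)
    qed (simp add: span_zero)
    have "y = ((t - \<rho> t) + (s - s0)) + (\<rho> t - r0)"
      by (simp add: y)
    then show "y \<in> span (D \<union> ?X)"
      using 1 2 by (simp only: span_add)
  qed
  then have "dim ((\<lambda>x. x - (r0 + s0)) ` (T + S)) \<le> dim (D \<union> ?X)"
    by (metis dim_mono dim_span)
  also have "\<dots> \<le> dim D + card ?X"
    using finR by (intro dim_Un_le_card) auto
  also have "card ?X \<le> card (R - {r0})"
    using finR by (intro card_image_le) auto
  finally have "dim ((\<lambda>x. x - (r0 + s0)) ` (T + S)) \<le> dim D + card (R - {r0})"
    by simp
  moreover have "r0 + s0 \<in> T + S"
    using r0 s0 \<rho>(1) by (auto simp: R_def intro: set_plus_intro)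
  then have "aff_dim (T + S) = int (dim ((\<lambda>x. x - (r0 + s0)) ` (T + S)))"
    by (intro aff_dim_eq_dim_subtract hull_inc)
  moreover have "aff_dim S = int (dim D)"
    unfolding D_def by (intro aff_dim_eq_dim_subtract hull_inc s0)
  moreover have "card (R - {r0}) + 1 = card R"
    using card.remove[OF finR r0] by simp
  ultimately have "e - f + 1 \<le> card R"
    using dim f by linarith
  then have cardR: "real e - real f + 1 \<le> real (card R)"
    using f(2) by linarith

  have C_sum: "sum a T = (\<Sum>r\<in>R. sum a (C r))"
    unfolding C_def by (rule sum.group[symmetric]) (use fin finR R_def in auto)
  have "(\<Sum>r\<in>R. sum a (C r) + sum c S + real f * min (sum a (C r)) (sum c S))
      \<le> (\<Sum>r\<in>R. sum g (C r + S))"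
  proof (rule sum_mono)
    fix r assume "r \<in> R"
    then have "sumset_bound f a c g (C r) S"
      by (intro bound) (auto simp: C_def R_def)
    then show "sum a (C r) + sum c S + real f * min (sum a (C r)) (sum c S) \<le> sum g (C r + S)"
      by (simp add: sumset_bound_def)
  qed
  also have "\<dots> = sum g (\<Union>r\<in>R. C r + S)"
  proof (rule sum.UNION_disjoint[symmetric])
    show "\<forall>r\<in>R. finite (C r + S)"
      using fin by (auto simp: C_def finite_set_plus)
    show "\<forall>r\<in>R. \<forall>r'\<in>R. r \<noteq> r' \<longrightarrow> (C r + S) \<inter> (C r' + S) = {}"
    proof (intro ballI impI, rule ccontr)
      fix r r' assume "r \<noteq> r'" "(C r + S) \<inter> (C r' + S) \<noteq> {}"
      then obtain t t' s s' where "t \<in> C r" "t' \<in> C r'" "s \<in> S" "s' \<in> S" "t + s = t' + s'"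
        by (auto elim!: set_plus_elim)
      moreover from this have "t - t' = s' - s"
        by (simp add: algebra_simps)
      ultimately have "\<rho> t = \<rho> t'"
        by (intro \<rho>_eq) (simp add: SU)
      then show False
        using \<open>t \<in> C r\<close> \<open>t' \<in> C r'\<close> \<open>r \<noteq> r'\<close> by (simp add: C_def)
    qed
  qed (rule finR)
  also have "(\<Union>r\<in>R. C r + S) = T + S"
    by (auto simp: C_def R_def set_plus_def)
  finally have main: "sum a T + real (card R) * sum c S
      + real f * (\<Sum>r\<in>R. min (sum a (C r)) (sum c S)) \<le> sum g (T + S)"
    by (simp add: sum.distrib C_sum sum_distrib_left)
  \<comment> \<open>At least \<open>e - f + 1\<close> copies of \<open>sum c S\<close> are
    available: one is the summand in the claim, and the other \<open>e - f\<close> raise the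
    coefficient of \<open>?m\<close> from \<open>f\<close> to \<open>e\<close>, because
    \<open>?m \<le> sum c S\<close>.\<close>
  let ?m = "min (sum a T) (sum c S)"
  have cS: "0 \<le> sum c S"
    using c by (simp add: sum_nonneg)
  have "?m \<le> (\<Sum>r\<in>R. min (sum a (C r)) (sum c S))"
    unfolding C_sum using a by (intro sum_min_le[OF finR _ cS] sum_nonneg) (auto simp: C_def)
  then have "real f * ?m \<le> real f * (\<Sum>r\<in>R. min (sum a (C r)) (sum c S))"
    by (simp add: mult_left_mono)
  moreover have "(real e - real f) * ?m \<le> (real e - real f) * sum c S"
    using f(2) by (intro mult_left_mono) auto
  moreover have "(real e - real f + 1) * sum c S \<le> real (card R) * sum c S"
    using cardR cS by (rule mult_right_mono)
  ultimately show ?thesis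
    using main unfolding sumset_bound_def by (simp add: algebra_simps)
qed

section \<open>Peeling off parallel faces\<close>

text \<open>On \<open>T1 + S1\<close> the functional \<open>l\<close> takes its top value
  \<open>\<beta> + \<gamma>\<close>; a summand from \<open>T - T1\<close> forces a strictly smaller
  value. So the two partial sumsets are disjoint.\<close>

lemma sum_face_plus_rest_le:
  fixes T S :: "'a::euclidean_space set"
  assumes fin: "finite T" "finite S"
    and g: "\<And>t s. t \<in> T \<Longrightarrow> s \<in> S \<Longrightarrow> (0::real) \<le> g (t + s)"
    and l: "\<And>t. t \<in> T \<Longrightarrow> l \<bullet> t \<le> \<beta>" "\<And>s. s \<in> S \<Longrightarrow> l \<bullet> s \<le> \<gamma>"
    and T1: "T1 = {t\<in>T. l \<bullet> t = \<beta>}" and S1: "S1 = {s\<in>S. l \<bullet> s = \<gamma>}"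
  shows "sum g (T1 + S1) + sum g ((T - T1) + S) \<le> sum g (T + S)"
proof -
  have disj: "(T1 + S1) \<inter> ((T - T1) + S) = {}"
  proof (rule ccontr)
    assume "\<not> ?thesis"
    then obtain t s t' s' where "t \<in> T1" "s \<in> S1" "t' \<in> T - T1" "s' \<in> S" "t + s = t' + s'"
      by (auto elim!: set_plus_elim)
    moreover from this have "l \<bullet> t + l \<bullet> s = l \<bullet> t' + l \<bullet> s'"
      by (simp flip: inner_add_right)
    ultimately show False
      using l(1)[of t'] l(2)[of s'] by (auto simp: T1 S1)
  qed
  have "finite T1" "finite S1"
    using fin by (auto simp: T1 S1)
  then have "sum g (T1 + S1) + sum g ((T - T1) + S) = sum g ((T1 + S1) \<union> ((T - T1) + S))"
    using disj fin by (simp add: sum.union_disjoint finite_set_plus)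
  also have "\<dots> \<le> sum g (T + S)"
  proof (rule sum_mono2)
    show "finite (T + S)"
      using fin by (rule finite_set_plus)
  qed (use g in \<open>auto simp: T1 S1 set_plus_def\<close>)
  finally show ?thesis .
qed

text \<open>Deleting \<open>T1\<close> lowers the required bound by at most
  \<open>(e + 2) * sum a T1\<close>. The face sum pays for this: it carries
  \<open>(e + 1) * sum a T1 + sum c S1\<close>, and \<open>S1\<close> is at least as heavy as
  \<open>T1\<close>.\<close>

lemma sumset_bound_remove_face:
  fixes T S :: "'a::euclidean_space set"
  assumes fin: "finite T" and a: "\<And>t. t \<in> T \<Longrightarrow> 0 \<le> a t" and "T1 \<subseteq> T"
    and total: "sum g (T1 + S1) + sum g ((T - T1) + S) \<le> sum g (T + S)"
    and lighter: "sum a T1 \<le> sum c S1"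
    and face: "sumset_bound e a c g T1 S1"
    and rest: "sumset_bound (Suc e) a c g (T - T1) S"
  shows "sumset_bound (Suc e) a c g T S"
proof -
  have diff: "sum a (T - T1) = sum a T - sum a T1"
    using fin \<open>T1 \<subseteq> T\<close> by (rule sum_diff)
  have "0 \<le> sum a T1"
    using a \<open>T1 \<subseteq> T\<close> by (auto intro: sum_nonneg)
  then have "min (sum a T) (sum c S) - sum a T1 \<le> min (sum a (T - T1)) (sum c S)"
    by (simp add: diff min_def)
  then have "real (Suc e) * (min (sum a T) (sum c S) - sum a T1)
      \<le> real (Suc e) * min (sum a (T - T1)) (sum c S)"
    by (intro mult_left_mono) auto
  moreover have "min (sum a T1) (sum c S1) = sum a T1"
    using lighter by simp
  ultimately show ?thesis
    using face rest total lighter diff unfolding sumset_bound_def by (simp add: algebra_simps)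
qed

lemma aff_dim_set_plus_ge:
  fixes T S :: "'a::euclidean_space set"
  assumes "S \<noteq> {}"
  shows "aff_dim T \<le> aff_dim (T + S)"
proof -
  obtain s where "s \<in> S"
    using assms by blast
  then have "(+) s ` T \<subseteq> T + S"
    by (auto simp: set_plus_def add.commute)
  then show ?thesis
    by (metis aff_dim_subset aff_dim_translation_eq)
qed

text \<open>The dimension condition is put on \<open>T + S\<close> alone so that it survives
  deletions: as long as both sets have dimension at least \<open>e\<close>, the one left intact
  keeps the sum large. If one of them has smaller dimension, the coset argument takes over.\<close>

lemma sumset_bound_aff_dim:
  fixes T S :: "'a::euclidean_space set"
  assumes "finite T" "finite S" "T \<noteq> {}" "S \<noteq> {}"
    and "\<And>t. t \<in> T \<Longrightarrow> 0 \<le> a t" and "\<And>s. s \<in> S \<Longrightarrow> 0 \<le> c s"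
    and "\<And>t s. t \<in> T \<Longrightarrow> s \<in> S \<Longrightarrow> a t + c s \<le> g (t + s)"
    and "int e \<le> aff_dim (T + S)"
  shows "sumset_bound e a c g T S"
  using assms
\<comment> \<open>The coset case and the face sum lower \<open>e\<close>; deleting a face lowers a
  cardinality.\<close>
proof (induction "e + card T + card S" arbitrary: e T S rule: less_induct)
  case less
  note fin = less.prems(1,2) and ne = less.prems(3,4)
    and a = less.prems(5) and c = less.prems(6) and g = less.prems(7) and dim = less.prems(8)
  show ?case
  proof (cases e)
    case 0
    then show ?thesis
      using sumset_bound_0[of T S a c g] fin ne a c g by simp
  next
    case (Suc e')
    consider "aff_dim S < int e" | "aff_dim T < int e" | "int e \<le> aff_dim S" "int e \<le> aff_dim T"
      by linarith
    then show ?thesis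
    proof cases
      case 1
      define f where "f = nat (aff_dim S)"
      have f: "aff_dim S = int f" "f < e"
        using 1 ne(2) aff_dim_geq[of S] aff_dim_empty[of S] by (auto simp: f_def)
      \<comment> \<open>Every \<open>T' + S\<close> contains a translate of \<open>S\<close>, so the
        induction hypothesis at level \<open>f\<close> applies to all nonempty parts of
        \<open>T\<close>.\<close>
      have "sumset_bound f a c g T' S" if T': "T' \<subseteq> T" "T' \<noteq> {}" for T'
      proof (rule less.hyps)
        show "f + card T' + card S < e + card T + card S"
          using f(2) card_mono[OF fin(1) T'(1)] by simp
        show "int f \<le> aff_dim (T' + S)"
          using aff_dim_set_plus_ge[OF T'(2), of S] f(1) by (simp add: add.commute)
      qed (use fin ne T' a c g finite_subset[OF T'(1) fin(1)] in auto)
      then show ?thesis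
        using f dim by (intro sumset_bound_cosets[OF fin ne a c]) auto
    next
      case 2
      define f where "f = nat (aff_dim T)"
      have f: "aff_dim T = int f" "f < e"
        using 2 ne(1) aff_dim_geq[of T] aff_dim_empty[of T] by (auto simp: f_def)
      have "sumset_bound f c a g S' T" if S': "S' \<subseteq> S" "S' \<noteq> {}" for S'
      proof -
        have "sumset_bound f a c g T S'"
        proof (rule less.hyps)
          show "f + card T + card S' < e + card T + card S"
            using f(2) card_mono[OF fin(2) S'(1)] by simp
          show "int f \<le> aff_dim (T + S')"
            using aff_dim_set_plus_ge[OF S'(2), of T] f(1) by simp
        qed (use fin ne S' a c g finite_subset[OF S'(1) fin(2)] in auto)
        then show ?thesis
          using sumset_bound_commute by blast
      qed
      then have "sumset_bound e c a g S T"
        using f dim by (intro sumset_bound_cosets[OF fin(2,1) ne(2,1) c a]) (auto simp: add.commute)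
      then show ?thesis
        using sumset_bound_commute by blast
    next
      case 3
      have "aff_dim T \<ge> 1"
        using 3 Suc by simp
      then obtain l \<beta> where l: "\<And>t. t \<in> T \<Longrightarrow> l \<bullet> t \<le> \<beta>"
        and facet: "aff_dim {t\<in>T. l \<bullet> t = \<beta>} = aff_dim T - 1"
        using facet_points_exist[OF fin(1)] by metis
      define \<gamma> where "\<gamma> = Max ((\<bullet>) l ` S)"
      have l': "l \<bullet> s \<le> \<gamma>" if "s \<in> S" for s
        using fin that by (simp add: \<gamma>_def)
      have "\<gamma> \<in> (\<bullet>) l ` S"
        unfolding \<gamma>_def using fin ne by (intro Max_in) auto
      define T1 where "T1 = {t\<in>T. l \<bullet> t = \<beta>}"
      define S1 where "S1 = {s\<in>S. l \<bullet> s = \<gamma>}"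
      have sub: "T1 \<subseteq> T" "S1 \<subseteq> S"
        by (auto simp: T1_def S1_def)
      have fin1: "finite T1" "finite S1"
        using sub fin finite_subset by auto
      have "aff_dim T1 \<ge> 0"
        using facet 3 Suc by (simp add: T1_def)
      then have "T1 \<noteq> {}" "S1 \<noteq> {}"
        using \<open>\<gamma> \<in> (\<bullet>) l ` S\<close> by (auto simp: S1_def)
      have card1: "card T1 \<le> card T" "card S1 \<le> card S" "card T1 > 0" "card S1 > 0"
        using card_mono fin sub fin1 \<open>T1 \<noteq> {}\<close> \<open>S1 \<noteq> {}\<close> by (auto simp: card_gt_0_iff)
      have face: "sumset_bound e' a c g T1 S1"
      proof (rule less.hyps)
        show "e' + card T1 + card S1 < e + card T + card S"
          using Suc card1 by simp
        have "int e' \<le> aff_dim T1"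
          using facet 3 Suc by (simp add: T1_def)
        also have "\<dots> \<le> aff_dim (T1 + S1)"
          by (rule aff_dim_set_plus_ge) fact
        finally show "int e' \<le> aff_dim (T1 + S1)" .
        show "a t + c s \<le> g (t + s)" if "t \<in> T1" "s \<in> S1" for t s
          using g sub that by blast
      qed (use fin1 \<open>T1 \<noteq> {}\<close> \<open>S1 \<noteq> {}\<close> sub a c in auto)
      have "aff_dim T1 < aff_dim T"
        using facet by (simp add: T1_def)
      then have "T - T1 \<noteq> {}"
        using sub by (metis Diff_eq_empty_iff order_antisym order_less_irrefl)
      have g0: "0 \<le> g (t + s)" if "t \<in> T" "s \<in> S" for t s
        using g[OF that] a[OF that(1)] c[OF that(2)] by simp
      have total: "sum g (T1 + S1) + sum g ((T - T1) + S) \<le> sum g (T + S)"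
        by (rule sum_face_plus_rest_le[where l = l])
          (use fin g0 l l' T1_def S1_def in auto)
      have g0': "0 \<le> g (s + t)" if "s \<in> S" "t \<in> T" for s t
        using g0[OF that(2,1)] by (simp add: add.commute)
      have total': "sum g (S1 + T1) + sum g ((S - S1) + T) \<le> sum g (S + T)"
        by (rule sum_face_plus_rest_le[where l = l])
          (use fin g0' l l' T1_def S1_def in auto)
      show ?thesis
      proof (cases "sum a T1 \<le> sum c S1")
        case True
        have "sumset_bound e a c g (T - T1) S"
        proof (rule less.hyps)
          show "e + card (T - T1) + card S < e + card T + card S"
            using card1 card_Diff_subset[OF fin1(1) sub(1)] by simp
          show "int e \<le> aff_dim (T - T1 + S)"
            using aff_dim_set_plus_ge[OF \<open>T - T1 \<noteq> {}\<close>, of S] 3 by (simp add: add.commute)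
        qed (use fin ne \<open>T - T1 \<noteq> {}\<close> a c g in auto)
        then show ?thesis
          unfolding Suc
          by (intro sumset_bound_remove_face[OF fin(1) a sub(1) total True face]) auto
      next
        case False
        show ?thesis
        \<comment> \<open>\<open>T1\<close> is a proper subset of \<open>T\<close>, but
          \<open>l\<close> may be constant on \<open>S\<close>. Then nothing of \<open>S\<close>
          remains, and the level-0 bound for \<open>(T - T1) + S\<close> supplies the one copy of
          \<open>sum c S\<close> missing from the face bound at level \<open>e'\<close>.\<close>
        proof (cases "S - S1 = {}")
          case True
          then have S1: "S1 = S"
            using sub by auto
          have "sumset_bound 0 a c g (T - T1) S"
            using sumset_bound_0[of "T - T1" S a c g] fin ne(2) \<open>T - T1 \<noteq> {}\<close> a c g by auto
          moreover have "sum a (T - T1) = sum a T - sum a T1"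
            using fin sub(1) by (intro sum_diff)
          moreover have "min (sum a T) (sum c S) \<le> sum c S" "min (sum a T1) (sum c S1) = sum c S"
            using False S1 by auto
          moreover from this have "e * min (sum a T) (sum c S) \<le> e * sum c S"
            by (intro mult_left_mono) auto
          ultimately show ?thesis
            using face total unfolding sumset_bound_def S1 Suc by (simp add: algebra_simps)
        next
          case ne': False
          have "sumset_bound e a c g T (S - S1)"
          proof (rule less.hyps)
            show "e + card T + card (S - S1) < e + card T + card S"
              using card1 card_Diff_subset[OF fin1(2) sub(2)] by simp
            show "int e \<le> aff_dim (T + (S - S1))"
              using aff_dim_set_plus_ge[OF ne', of T] 3 by simp
          qed (use fin ne ne' a c g in auto)
          then have "sumset_bound e c a g (S - S1) T"
            using sumset_bound_commute by blast
          moreover have "sumset_bound e' c a g S1 T1"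
            using face sumset_bound_commute by blast
          ultimately have "sumset_bound e c a g S T"
            unfolding Suc using False
            by (intro sumset_bound_remove_face[OF fin(2) c sub(2) total']) auto
          then show ?thesis
            using sumset_bound_commute by blast
        qed
      qed
    qed
  qed
qed

section \<open>Weighted difference sets\<close>

lemma finite_diffset: "finite A \<Longrightarrow> finite B \<Longrightarrow> finite (diffset A B)"
  unfolding diffset_def by (simp add: finite_image_set2)

lemma diffset_mono: "A \<subseteq> A' \<Longrightarrow> B \<subseteq> B' \<Longrightarrow> diffset A B \<subseteq> diffset A' B'"
  unfolding diffset_def by blast

text \<open>Reflecting \<open>S\<close> turns differences into sums, with the weights transported
  along the reflection.\<close>

lemma sumset_bound_diffset:
  fixes T S :: "'a::euclidean_space set"
  assumes "finite T" "finite S" "T \<noteq> {}" "S \<noteq> {}"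
    and "\<And>t. t \<in> T \<Longrightarrow> 0 \<le> a t" and "\<And>s. s \<in> S \<Longrightarrow> 0 \<le> a s"
    and g: "\<And>t s. t \<in> T \<Longrightarrow> s \<in> S \<Longrightarrow> a t + a s \<le> g (t - s)"
    and dim: "int e \<le> aff_dim T"
  shows "sum a T + sum a S + real e * min (sum a T) (sum a S) \<le> sum g (diffset T S)"
proof -
  have "sumset_bound e a (a \<circ> uminus) g T (uminus ` S)"
  proof (rule sumset_bound_aff_dim)
    show "int e \<le> aff_dim (T + uminus ` S)"
      using dim aff_dim_set_plus_ge[of "uminus ` S" T] \<open>S \<noteq> {}\<close> by simp
    show "a t + (a \<circ> uminus) s \<le> g (t + s)" if "t \<in> T" "s \<in> uminus ` S" for t s
      using that g by force
  qed (use assms in auto)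
  moreover have "T + uminus ` S = diffset T S"
    by (auto simp: diffset_def set_plus_def)
  moreover have "sum (a \<circ> uminus) (uminus ` S) = sum a S"
    by (simp add: sum.reindex)
  ultimately show ?thesis
    by (simp add: sumset_bound_def)
qed

text \<open>The differences between \<open>T\<close> and \<open>S\<close>, in both orders, give
  \<open>2 * sum a T + 2 * n * sum a S\<close>. The second term is the exact cost of deleting
  \<open>S\<close>. The first is only needed when the dimension drops to \<open>n - 1\<close>, where
  it lifts the coefficient of \<open>sum a T\<close> from \<open>2 * (n - 1)\<close> to
  \<open>2 * n\<close>.\<close>

lemma diffset_bound:
  fixes B :: "'a::euclidean_space set"
  assumes "finite B" and "aff_dim B = int n"
    and "\<And>b. b \<in> B \<Longrightarrow> 0 \<le> a b"
    and "\<And>b b'. b \<in> B \<Longrightarrow> b' \<in> B \<Longrightarrow> a b + a b' \<le> g (b - b')"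
  shows "2 * real n * sum a B \<le> sum g (diffset B B - {0})"
  using assms
proof (induction "n + card B" arbitrary: n B rule: less_induct)
  case less
  note fin = less.prems(1) and dim = less.prems(2) and a = less.prems(3) and g = less.prems(4)
  have finD: "finite (diffset B B)"
    using fin by (simp add: finite_diffset)
  have g0: "0 \<le> g x" if "x \<in> diffset B B" for x
  proof -
    from that obtain b b' where "b \<in> B" "b' \<in> B" "x = b - b'"
      by (auto simp: diffset_def)
    then show ?thesis
      using a[of b] a[of b'] g[of b b'] by simp
  qed
  show ?case
  proof (cases n)
    case 0
    then show ?thesis
      using g0 by (auto intro: sum_nonneg)
  next
    case (Suc e)
    \<comment> \<open>Facets are recorded by their points in \<open>B\<close>, which makes the
      family finite and a heaviest member available.\<close>
    define \<F> where "\<F> = {F. \<exists>l \<beta>. (\<forall>x\<in>B. l \<bullet> x \<le> \<beta>) \<and> F = {x\<in>B. l \<bullet> x = \<beta>} \<and> aff_dim F = int e}"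
    have "finite \<F>"
      by (rule finite_subset[of _ "Pow B"]) (use fin in \<open>auto simp: \<F>_def\<close>)
    moreover have "\<F> \<noteq> {}"
    proof -
      have "aff_dim B \<ge> 1"
        using dim Suc by simp
      then obtain l \<beta> where "\<And>x. x \<in> B \<Longrightarrow> l \<bullet> x \<le> \<beta>"
        "aff_dim {x\<in>B. l \<bullet> x = \<beta>} = aff_dim B - 1"
        using facet_points_exist[OF fin] by metis
      then have "{x\<in>B. l \<bullet> x = \<beta>} \<in> \<F>"
        using dim Suc by (auto simp: \<F>_def)
      then show ?thesis
        by blast
    qed
    ultimately have "Max (sum a ` \<F>) \<in> sum a ` \<F>"
      by (intro Max_in) auto
    then obtain T where T: "T \<in> \<F>" "sum a T = Max (sum a ` \<F>)"
      by (metis imageE)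
    have T_max: "sum a F \<le> sum a T" if "F \<in> \<F>" for F
      using \<open>finite \<F>\<close> that T(2) by simp
    from T(1) obtain l \<beta> where l: "\<And>x. x \<in> B \<Longrightarrow> l \<bullet> x \<le> \<beta>" and T_def: "T = {x\<in>B. l \<bullet> x = \<beta>}"
      and dimT: "aff_dim T = int e"
      unfolding \<F>_def by blast
    have "T \<noteq> {}"
      using dimT by auto
    have "T \<noteq> B"
      using dimT dim Suc by auto
    define m where "m = Min ((\<bullet>) l ` B)"
    have m: "m \<le> l \<bullet> x" if "x \<in> B" for x
      using fin that by (simp add: m_def)
    have "m \<in> (\<bullet>) l ` B"
      unfolding m_def using fin \<open>T \<noteq> {}\<close> by (intro Min_in) (auto simp: T_def)
    then obtain x0 where x0: "x0 \<in> B" "l \<bullet> x0 = m"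
      by blast
    have "m < \<beta>"
    proof -
      obtain y where "y \<in> B" "l \<bullet> y \<noteq> \<beta>"
        using \<open>T \<noteq> B\<close> by (auto simp: T_def)
      then show ?thesis
        using m[of y] l[of y] by simp
    qed
    define S where "S = {x\<in>B. l \<bullet> x = m}"
    have sub: "T \<subseteq> B" "S \<subseteq> B" "T \<subseteq> B - S" and fin': "finite T" "finite S" "finite (B - S)"
      using fin \<open>m < \<beta>\<close> by (auto simp: T_def S_def)
    have "S \<noteq> {}"
      using x0 by (auto simp: S_def)
    obtain x1 where x1: "x1 \<in> B" "l \<bullet> x1 = \<beta>"
      using \<open>T \<noteq> {}\<close> by (auto simp: T_def)
    \<comment> \<open>\<open>S\<close> minimises \<open>l\<close>, hence maximises
      \<open>- l\<close>. The facet around it is compared with the heaviest one,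
      \<open>T\<close>.\<close>
    obtain l' \<beta>' where l': "\<And>x. x \<in> B \<Longrightarrow> l' \<bullet> x \<le> \<beta>'"
      and S_facet: "{x\<in>B. (- l) \<bullet> x = - m} \<subseteq> {x\<in>B. l' \<bullet> x = \<beta>'}"
      and dim': "aff_dim {x\<in>B. l' \<bullet> x = \<beta>'} = aff_dim B - 1"
      by (rule face_subset_facet_points[OF fin, of "- l" "- m" x0 x1])
        (use m x0 x1 \<open>m < \<beta>\<close> in auto)
    have "sum a S \<le> sum a {x\<in>B. l' \<bullet> x = \<beta>'}"
      using S_facet fin a by (intro sum_mono2) (auto simp: S_def)
    also have "\<dots> \<le> sum a T"
      by (rule T_max) (use l' dim' dim Suc in \<open>auto simp: \<F>_def\<close>)
    finally have lighter: "sum a S \<le> sum a T" .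

    \<comment> \<open>Stated for a general \<open>h\<close>, to be used with \<open>g\<close> for
      \<open>T - S\<close> and with \<open>g \<circ> uminus\<close> for \<open>S - T\<close>. The
      minimum is \<open>sum a S\<close>, and \<open>1 + e = n\<close>.\<close>
    have TS: "sum a T + real n * sum a S \<le> sum h (diffset T S)"
      if "\<And>t s. t \<in> T \<Longrightarrow> s \<in> S \<Longrightarrow> a t + a s \<le> h (t - s)" for h
    proof -
      have "sum a T + sum a S + real e * min (sum a T) (sum a S) \<le> sum h (diffset T S)"
        by (rule sumset_bound_diffset)
          (use that fin' \<open>T \<noteq> {}\<close> \<open>S \<noteq> {}\<close> sub a dimT in auto)
      then show ?thesis
        using lighter by (simp add: Suc algebra_simps min_absorb2)
    qed
    have pos: "sum a T + real n * sum a S \<le> sum g (diffset T S)"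
      by (rule TS) (use g sub in auto)
    have "sum a T + real n * sum a S \<le> sum (g \<circ> uminus) (diffset T S)"
    proof (rule TS)
      fix t s assume "t \<in> T" "s \<in> S"
      then have "a s + a t \<le> g (s - t)"
        using g sub by blast
      then show "a t + a s \<le> (g \<circ> uminus) (t - s)"
        by simp
    qed
    also have "\<dots> = sum g (uminus ` diffset T S)"
      by (simp add: sum.reindex)
    also have "uminus ` diffset T S = diffset S T"
      by (force simp: diffset_def image_iff)
    finally have neg: "sum a T + real n * sum a S \<le> sum g (diffset S T)" .

    let ?D = "diffset (B - S) (B - S) - {0}"
    have lT: "l \<bullet> x = \<beta> - m" if "x \<in> diffset T S" for x
      using that by (auto simp: diffset_def T_def S_def inner_diff_right)
    have lS: "l \<bullet> x = m - \<beta>" if "x \<in> diffset S T" for x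
      using that by (auto simp: diffset_def T_def S_def inner_diff_right)
    \<comment> \<open>Without the bottom level \<open>m\<close>, the values of \<open>l\<close> lie
      in a half-open interval of length \<open>\<beta> - m\<close>, so no difference attains the
      full width.\<close>
    have lD: "m - \<beta> < l \<bullet> x" "l \<bullet> x < \<beta> - m" if "x \<in> ?D" for x
    proof -
      from that obtain b b' where "b \<in> B" "b' \<in> B" "l \<bullet> b \<noteq> m" "l \<bullet> b' \<noteq> m" "x = b - b'"
        by (auto simp: diffset_def S_def)
      then show "m - \<beta> < l \<bullet> x" "l \<bullet> x < \<beta> - m"
        using m[of b] m[of b'] l[of b] l[of b'] by (auto simp: inner_diff_right)
    qed
    have disj: "diffset T S \<inter> diffset S T = {}" "(diffset T S \<union> diffset S T) \<inter> ?D = {}"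
      using lT lS lD \<open>m < \<beta>\<close> by force+
    have finTS: "finite (diffset T S)" "finite (diffset S T)" "finite ?D"
      using fin' by (simp_all add: finite_diffset)
    have "sum g (diffset T S) + sum g (diffset S T) + sum g ?D
        = sum g (diffset T S \<union> diffset S T \<union> ?D)"
      using disj finTS by (simp add: sum.union_disjoint)
    also have "\<dots> \<le> sum g (diffset B B - {0})"
    proof (rule sum_mono2)
      have "0 \<notin> diffset T S" "0 \<notin> diffset S T"
        using lT[of 0] lS[of 0] \<open>m < \<beta>\<close> by auto
      then show "diffset T S \<union> diffset S T \<union> ?D \<subseteq> diffset B B - {0}"
        using diffset_mono[OF sub(1,2)] diffset_mono[OF sub(2,1)]
          diffset_mono[of "B - S" B "B - S" B] by blast
    qed (use finD g0 in auto)
    finally have total: "2 * (sum a T + real n * sum a S) + sum g ?D \<le> sum g (diffset B B - {0})"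
      using pos neg by simp
    have split: "sum a B = sum a (B - S) + sum a S"
      using sum.subset_diff[OF sub(2) fin] by simp
    have "card (B - S) < card B"
      using fin \<open>S \<noteq> {}\<close> sub by (intro psubset_card_mono) auto
    show ?thesis
    proof (cases "aff_dim (B - S) = int n")
      case True
      have "2 * real n * sum a (B - S) \<le> sum g ?D"
        by (rule less.hyps) (use \<open>card (B - S) < card B\<close> fin' True a g in auto)
      moreover have "0 \<le> sum a T"
        using a sub by (auto intro: sum_nonneg)
      ultimately show ?thesis
        using total by (simp add: split algebra_simps)
    next
      case False
      have le: "aff_dim (B - S) \<le> int e"
        using aff_dim_subset[of "B - S" B] False dim Suc by auto
      \<comment> \<open>\<open>T\<close> already has dimension \<open>e\<close>, so every point of
        \<open>B - S\<close> lies in its affine hull, where \<open>l\<close> is constantly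
        \<open>\<beta>\<close>.\<close>
      have "B - S \<subseteq> T"
      proof
        fix x assume x: "x \<in> B - S"
        have "aff_dim (insert x T) \<le> int e"
          using aff_dim_subset[of "insert x T" "B - S"] x sub le by auto
        then have "x \<in> affine hull T"
          using dimT by (auto simp: aff_dim_insert split: if_splits)
        also have "affine hull T \<subseteq> {x. l \<bullet> x = \<beta>}"
          by (rule hull_minimal) (auto simp: T_def affine_hyperplane)
        finally show "x \<in> T"
          using x by (simp add: T_def)
      qed
      then have BT: "B - S = T"
        using sub by auto
      have "2 * real e * sum a T \<le> sum g (diffset T T - {0})"
        by (rule less.hyps) (use \<open>card (B - S) < card B\<close> BT Suc fin' dimT sub a g in auto)
      then show ?thesis
        using total by (simp add: split BT Suc algebra_simps)
    qed
  qed
qed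

text \<open>The sets \<open>X - Max Y\<close> and \<open>Max X - Y\<close> both consist of
  differences and can share only \<open>Max X - Max Y\<close>.\<close>

lemma card_diffset_real_ge:
  fixes X Y :: "real set"
  assumes "finite X" "finite Y" "X \<noteq> {}" "Y \<noteq> {}"
  shows "card X + card Y \<le> card (diffset X Y) + 1"
proof -
  let ?P = "(\<lambda>x. x - Max Y) ` X" and ?Q = "(\<lambda>y. Max X - y) ` Y"
  have "?P \<inter> ?Q \<subseteq> {Max X - Max Y}"
  proof
    fix z assume "z \<in> ?P \<inter> ?Q"
    then obtain x y where "x \<in> X" "y \<in> Y" "z = x - Max Y" "z = Max X - y"
      by blast
    moreover from this have "x \<le> Max X" "y \<le> Max Y"
      using assms by auto
    ultimately show "z \<in> {Max X - Max Y}"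
      by simp
  qed
  then have "card (?P \<inter> ?Q) \<le> 1"
    using card_mono[of "{Max X - Max Y}"] by simp
  moreover have "card ?P = card X" "card ?Q = card Y"
    by (simp_all add: card_image inj_on_def)
  moreover have "card ?P + card ?Q = card (?P \<union> ?Q) + card (?P \<inter> ?Q)"
    using assms by (intro card_Un_Int) auto
  moreover have "card (?P \<union> ?Q) \<le> card (diffset X Y)"
    using assms Max_in[OF assms(1,3)] Max_in[OF assms(2,4)]
    by (intro card_mono finite_diffset) (unfold diffset_def, blast+)
  ultimately show ?thesis
    by simp
qed

section \<open>Projection along a line\<close>

text \<open>Orthogonal projection along \<open>v\<close>, kept inside the ambient space instead of a
  quotient; the lost dimension is visible only in \<open>aff_dim\<close>.\<close>

definition project_off :: "'a::real_inner \<Rightarrow> 'a \<Rightarrow> 'a" where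
  "project_off v x = x - (x \<bullet> v / (v \<bullet> v)) *\<^sub>R v"

lemma project_off_diff: "project_off v (x - y) = project_off v x - project_off v y"
  by (simp add: project_off_def inner_diff_left diff_divide_distrib scaleR_left_diff_distrib)

lemma project_off_add: "project_off v (x + y) = project_off v x + project_off v y"
  by (simp add: project_off_def inner_add_left add_divide_distrib scaleR_left_distrib)

lemma project_off_eq_0_iff:
  assumes "v \<noteq> 0"
  shows "project_off v x = 0 \<longleftrightarrow> x \<in> line_through_0 v"
proof
  assume "x \<in> line_through_0 v"
  then show "project_off v x = 0"
    using assms by (auto simp: project_off_def line_through_0_def)
qed (auto simp: project_off_def line_through_0_def)

text \<open>A vector differs from its projection by a multiple of \<open>v\<close>, so one extra
  generator recovers the span.\<close>

lemma aff_dim_le_project_off: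
  fixes A :: "'a::euclidean_space set"
  assumes "A \<noteq> {}"
  shows "aff_dim A \<le> aff_dim (project_off v ` A) + 1"
proof -
  obtain x0 where x0: "x0 \<in> A"
    using assms by blast
  let ?D = "(\<lambda>y. y - project_off v x0) ` project_off v ` A"
  have "(\<lambda>x. x - x0) ` A \<subseteq> span (?D \<union> {v})"
  proof
    fix y assume "y \<in> (\<lambda>x. x - x0) ` A"
    then obtain x where x: "x \<in> A" "y = x - x0"
      by blast
    have "project_off v y + (y \<bullet> v / (v \<bullet> v)) *\<^sub>R v \<in> span (?D \<union> {v})"
      using x by (intro span_add span_scale span_base) (auto simp: project_off_diff)
    then show "y \<in> span (?D \<union> {v})"
      by (simp add: project_off_def)
  qed
  then have "dim ((\<lambda>x. x - x0) ` A) \<le> dim (?D \<union> {v})"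
    by (metis dim_mono dim_span)
  also have "\<dots> \<le> dim ?D + 1"
    using dim_Un_le_card[of "{v}" ?D] by simp
  finally show ?thesis
    using aff_dim_eq_dim_subtract[OF hull_inc[OF x0]]
      aff_dim_eq_dim_subtract[OF hull_inc[OF imageI[OF x0, of "project_off v"]]]
    by simp
qed

text \<open>The coordinate \<open>x \<bullet> v\<close> is injective on each fibre, which reduces
  the claim to finite sets of reals.\<close>

lemma card_fibre_diffset_ge:
  fixes A :: "'a::euclidean_space set"
  assumes "finite A" and "b \<in> project_off v ` A" and "b' \<in> project_off v ` A"
  shows "card {x\<in>A. project_off v x = b} + card {x\<in>A. project_off v x = b'}
    \<le> card {x \<in> diffset A A. project_off v x = b - b'} + 1"
proof -
  let ?F = "\<lambda>b. {x\<in>A. project_off v x = b}" and ?h = "\<lambda>x. x \<bullet> v"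
  have card_h: "card (?h ` ?F b) = card (?F b)" for b
  proof (rule card_image, rule inj_onI)
    fix x y assume "x \<in> ?F b" "y \<in> ?F b" "x \<bullet> v = y \<bullet> v"
    then show "x = y"
      by (auto simp: project_off_def)
  qed
  have "card (?h ` ?F b) + card (?h ` ?F b') \<le> card (diffset (?h ` ?F b) (?h ` ?F b')) + 1"
    using assms by (intro card_diffset_real_ge) auto
  moreover have "diffset (?h ` ?F b) (?h ` ?F b') \<subseteq> ?h ` {x \<in> diffset A A. project_off v x = b - b'}"
  proof
    fix z assume "z \<in> diffset (?h ` ?F b) (?h ` ?F b')"
    then obtain x y where xy: "x \<in> ?F b" "y \<in> ?F b'" "z = (x - y) \<bullet> v"
      by (auto simp: diffset_def inner_diff_left)
    then have "x - y \<in> {x \<in> diffset A A. project_off v x = b - b'}"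
      by (auto simp: diffset_def project_off_diff)
    then show "z \<in> ?h ` {x \<in> diffset A A. project_off v x = b - b'}"
      using xy(3) by blast
  qed
  then have "card (diffset (?h ` ?F b) (?h ` ?F b'))
      \<le> card {x \<in> diffset A A. project_off v x = b - b'}"
    using assms(1) by (intro surj_card_le) (auto simp: finite_diffset)
  ultimately show ?thesis
    by (simp add: card_h)
qed

section \<open>From fibre counts to the bound for \<open>A - A\<close>\<close>

theorem theorem1p3:
  fixes A :: "(real ^ 'd) set" and v :: "real ^ 'd"
    and r :: nat and t :: "nat \<Rightarrow> real ^ 'd"
  assumes "finite A" and "A \<noteq> {}"
    and "aff_dim A = int CARD('d)"
    and "v \<noteq> 0"
    and "A \<subseteq> (\<Union>i<r. (\<lambda>x. t i + x) ` line_through_0 v)"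
  shows "int (card (diffset A A - line_through_0 v))
    \<ge> (2 * int CARD('d) - 2) * int (card A) - 2 * (int CARD('d))\<^sup>2 * int r"
proof -
  define \<pi> where "\<pi> = project_off v"
  define B where "B = \<pi> ` A"
  define F where "F b = {x\<in>A. \<pi> x = b}" for b
  \<comment> \<open>Subtracting one from each fibre size absorbs the loss in the one-dimensional
    bound. The total weight becomes \<open>card A - card B\<close>, hence at least
    \<open>card A - r\<close>.\<close>
  define a where "a b = real (card (F b)) - 1" for b
  define g where "g y = real (card {x \<in> diffset A A. \<pi> x = y})" for y
  define n where "n = nat (aff_dim B)"
  have finB: "finite B" and "B \<noteq> {}"
    using assms by (auto simp: B_def)
  then have n: "aff_dim B = int n"
    using aff_dim_geq[of B] aff_dim_empty[of B] by (auto simp: n_def)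
  have dn: "CARD('d) \<le> n + 1"
    using aff_dim_le_project_off[OF assms(2), of v] n assms(3) by (simp add: B_def \<pi>_def)
  have F_pos: "card (F b) \<ge> 1" if "b \<in> B" for b
  proof -
    have "F b \<noteq> {}" "finite (F b)"
      using that assms(1) by (auto simp: F_def B_def)
    then show ?thesis
      by (simp add: Suc_leI card_gt_0_iff)
  qed
  \<comment> \<open>Each translate of the line projects to a single point.\<close>
  have "B \<subseteq> (\<lambda>i. \<pi> (t i)) ` {..<r}"
  proof
    fix b assume "b \<in> B"
    then obtain x where "x \<in> A" "b = \<pi> x"
      by (auto simp: B_def)
    moreover from this obtain i y where "i < r" "y \<in> line_through_0 v" "x = t i + y"
      using assms(5) by blast
    ultimately have "b = \<pi> (t i)"
      using project_off_eq_0_iff[OF assms(4)] by (simp add: \<pi>_def project_off_add)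
    then show "b \<in> (\<lambda>i. \<pi> (t i)) ` {..<r}"
      using \<open>i < r\<close> by simp
  qed
  then have "card B \<le> r"
    using surj_card_le[of "{..<r}"] by simp
  have "card A = (\<Sum>b\<in>B. card (F b))"
    unfolding card_eq_sum F_def by (rule sum.group[symmetric]) (use assms(1) finB B_def in auto)
  then have sum_a: "sum a B = real (card A) - real (card B)"
    by (simp add: a_def sum_subtractf)
  have sum_a_nonneg: "0 \<le> sum a B"
    using F_pos by (intro sum_nonneg) (simp add: a_def)
  have bound: "2 * real n * sum a B \<le> sum g (diffset B B - {0})"
  proof (rule diffset_bound[OF finB n])
    show "0 \<le> a b" if "b \<in> B" for b
      using F_pos[OF that] by (simp add: a_def)
    show "a b + a b' \<le> g (b - b')" if "b \<in> B" "b' \<in> B" for b b'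
      using card_fibre_diffset_ge[OF assms(1), of b v b'] that
      by (simp add: a_def g_def F_def B_def \<pi>_def)
  qed
  let ?D = "diffset A A - line_through_0 v"
  have finD: "finite (diffset A A)"
    using assms(1) by (simp add: finite_diffset)
  have "\<pi> ` ?D \<subseteq> diffset B B - {0}"
  proof
    fix y assume "y \<in> \<pi> ` ?D"
    then obtain x where x: "x \<in> diffset A A" "x \<notin> line_through_0 v" "y = \<pi> x"
      by blast
    then have "y \<noteq> 0"
      using project_off_eq_0_iff[OF assms(4)] by (simp add: \<pi>_def)
    then show "y \<in> diffset B B - {0}"
      using x unfolding diffset_def B_def \<pi>_def by (auto simp: project_off_diff) blast
  qed
  then have "card ?D = (\<Sum>y\<in>diffset B B - {0}. card {x \<in> ?D. \<pi> x = y})"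
    unfolding card_eq_sum
    by (intro sum.group[symmetric]) (use finD finB finite_diffset in auto)
  \<comment> \<open>The line is the kernel of \<open>\<pi>\<close>, so fibres over nonzero
    \<open>y\<close> avoid it.\<close>
  also have "\<dots> = (\<Sum>y\<in>diffset B B - {0}. card {x \<in> diffset A A. \<pi> x = y})"
    using project_off_eq_0_iff[OF assms(4)]
    by (intro sum.cong arg_cong[where f = card]) (auto simp: \<pi>_def)
  finally have card_D: "real (card ?D) = sum g (diffset B B - {0})"
    by (simp add: g_def)
  let ?d = "real CARD('d)"
  have d: "1 \<le> ?d"
    by (simp add: Suc_leI)
  have "(2 * ?d - 2) * (real (card A) - real r) \<le> (2 * ?d - 2) * sum a B"
    using \<open>card B \<le> r\<close> d by (intro mult_left_mono) (auto simp: sum_a)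
  also have "\<dots> \<le> 2 * real n * sum a B"
    using dn sum_a_nonneg by (intro mult_right_mono) linarith+
  also have "\<dots> \<le> real (card ?D)"
    using bound card_D by simp
  finally have "(2 * ?d - 2) * (real (card A) - real r) \<le> real (card ?D)" .
  \<comment> \<open>The loss incurred is \<open>(2 * d - 2) * r\<close>, which is below the allowed
    \<open>2 * d^2 * r\<close>.\<close>
  moreover have "(2 * ?d - 2) * real r \<le> 2 * ?d\<^sup>2 * real r"
  proof (rule mult_right_mono)
    have "?d * 1 \<le> ?d * ?d"
      using d by (intro mult_left_mono) auto
    then show "2 * ?d - 2 \<le> 2 * ?d\<^sup>2"
      unfolding power2_eq_square using d by linarith
  qed simp
  ultimately have "(2 * ?d - 2) * real (card A) - 2 * ?d\<^sup>2 * real r \<le> real (card ?D)"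
    by (simp add: algebra_simps)
  then have "real_of_int ((2 * int CARD('d) - 2) * int (card A) - 2 * (int CARD('d))\<^sup>2 * int r)
      \<le> real_of_int (int (card ?D))"
    by simp
  then show ?thesis
    by (simp only: of_int_le_iff)
qed

end
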